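(* Let $\Phi$ be any real-valued objective that depends only on the stationary workloads and the long-run overlapping-region assignment rates, i.e. a function $\Phi(\rho,x)$ of $\rho=(\rho_i)_{i\in\mathcal I}$ and $x=(x_{ei})_{e\in\mathcal E,\,i\in e}$. Then $$\inf_{\eta\in\mathcal H_{\mathrm{st}}}\Phi\left(\rho^\eta,x^\eta\right)=\inf_{\substack{x\in\mathcal X:\\ a_i(x)<\mu_i\ \forall i\in\mathcal I}}\Phi\left(\left(\frac{a_i(x)}{\mu_i}\right)_{i\in\mathcal I},\,x\right).$$ In particular, state dependence cannot improve an objective based only on the individual workloads, their variance, or the unconditional dispatch fractions: for such an objective, the infimum over $\mathcal H_{\mathrm{st}}$ equals the infimum over the state-independent policies in $\mathcal H_{\mathrm{st}}$.
   Context: System. $\mathcal I=\{1,\dots,I\}$ is a finite nonempty set of servers. $\mathcal E$ is a finite set of nonempty subsets of $\mathcal I$ (hyperedges), with $e\not\subseteq e'$ for distinct $e,e'\in\mathcal E$; each $e$ represents an overlapping service region whose calls may be served by any server in $e$. Each server $i$ also has a primary region whose calls can be served only by $i$. Calls arrive by independent Poisson processes with rates $\lambda_i\ge 0$ (primary region of $i$) and $\lambda_e\ge 0$ (overlapping region $e$); $\lambda:=\sum_{i\in\mathcal I}\lambda_i+\sum_{e\in\mathcal E}\lambda_e$. Server $i$ has exponential service times with rate $\mu_i>0$ and its own infinite-capacity queue. Dispatch policies and the Markov chain. States are vectors $B=(n_i)_{i\in\mathcal I}\in\mathbb Z_+^I$, where $n_i$ is the number of calls at server $i$ (in service plus waiting).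 States are enumerated as $B_u$, $u\in\mathcal U=\{0,1,2,\dots\}$, by a fixed bijection. A Markovian dispatch policy is a family $\eta=\{\eta_{e,u}: e\in\mathcal E,u\in\mathcal U\}$ where $\eta_{e,u}$ is a probability distribution on $\mathcal I$ supported on $e$; $\eta_{e,u}(i)$ is the probability that a call from region $e$ arriving in state $B_u$ is assigned to server $i$. The policy is state-independent if $\eta_{e,u}$ does not depend on $u$. Under $\eta$ the system is the continuous-time Markov chain (CTMC) on $\mathbb Z_+^I$ with transition rates (where $\mathbf e_i$ is the $i$-th unit vector): from $B_u$ to $B_u+\mathbf e_i$ at rate $\lambda_i+\sum_{e\in\mathcal E}\eta_{e,u}(i)\lambda_e$, and from $B_u$ to $B_u-\mathbf e_i$ at rate $\mu_i$ if $(B_u)_i>0$; no other transitions. Stability. $\mathcal H_{\mathrm{st}}$ is the set of Markovian dispatch policies under which this CTMC is positive recurrent ("stable"), in the sense that it admits a stationary probability distribution (unique, since the all-zero state is reachable from every state), denoted $\pi^\eta=(\pi_u^\eta)_{u\in\mathcal U}$. For $\eta\in\mathcal H_{\mathrm{st}}$, the workload of server $i$ is $\rho_i^\eta:=\sum_{u\in\mathcal U}\mathbf 1\{(B_u)_i>0\}\pi_u^\eta$, $\rho^\eta:=(\rho^\eta_i)_{i\in\mathcal I}$, and the long-run assignment rates are $x_{ei}^\eta:=\lambda_e\sum_{u\in\mathcal U}\pi_u^\eta\,\eta_{e,u}(i)$ for $e\in\mathcal E$, $i\in e$, with $x^\eta:=(x^\eta_{ei})$. The unconditional dispatch fractions (for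 $\lambda>0$) are $x_{ei}^\eta/\lambda$ for $i\in e$ (and $0$ for $i\notin e$), together with $\lambda_i/\lambda$ for dispatches of server $i$ to its primary region. Flows. The hyperedge-flow polytope is $$\mathcal X:=\Big\{x=(x_{ei})_{e\in\mathcal E,\,i\in e}:\ x_{ei}\ge 0,\ \sum_{i\in e}x_{ei}=\lambda_e\ \ \forall e\in\mathcal E\Big\},$$ and for $x\in\mathcal X$, $a_i(x):=\lambda_i+\sum_{e\in\mathcal E:\,i\in e}x_{ei}$. The infimum over an empty set is $+\infty$. *)

theory Defs
  imports "HOL-Probability.Probability"
begin

text \<open>
  The servers are the elements of a (nonempty) finite type \<open>'i\<close>; a state \<open>(n\<^sub>i)\<close> is a function
  \<open>'i \<Rightarrow> nat\<close>, and \<open>state S u\<close> is the state \<open>B\<^sub>u\<close>.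
\<close>

record 'i system =
  hyperedges :: "'i set set"
  primary_rate :: "'i \<Rightarrow> real"
  overlap_rate :: "'i set \<Rightarrow> real"
  service_rate :: "'i \<Rightarrow> real"
  state :: "nat \<Rightarrow> 'i \<Rightarrow> nat"

locale dispatch_system =
  fixes S :: "'i::finite system"
  assumes hyperedge_nonempty: "e \<in> hyperedges S \<Longrightarrow> e \<noteq> {}"
    and hyperedge_antichain:
      "\<lbrakk>e \<in> hyperedges S; e' \<in> hyperedges S; e \<noteq> e'\<rbrakk> \<Longrightarrow> \<not> e \<subseteq> e'"
    and primary_rate_nonneg: "primary_rate S i \<ge> 0"
    and overlap_rate_nonneg: "e \<in> hyperedges S \<Longrightarrow> overlap_rate S e \<ge> 0"
    and service_rate_pos: "service_rate S i > 0"
    and state_bij: "bij (state S)"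

definition total_rate :: "'i::finite system \<Rightarrow> real" where
  "total_rate S = (\<Sum>i\<in>UNIV. primary_rate S i) + (\<Sum>e\<in>hyperedges S. overlap_rate S e)"


type_synonym 'i policy = "'i set \<Rightarrow> nat \<Rightarrow> 'i pmf"

text \<open>Values of a policy at sets that are not hyperedges are irrelevant.\<close>

definition policies :: "'i::finite system \<Rightarrow> 'i policy set" where
  "policies S = {\<eta>. \<forall>e\<in>hyperedges S. \<forall>u. set_pmf (\<eta> e u) \<subseteq> e}"

definition state_independent :: "'i::finite system \<Rightarrow> 'i policy \<Rightarrow> bool" where
  "state_independent S \<eta> \<longleftrightarrow> (\<forall>e\<in>hyperedges S. \<forall>u v. \<eta> e u = \<eta> e v)"


definition arrival_rate :: "'i::finite system \<Rightarrow> 'i policy \<Rightarrow> nat \<Rightarrow> 'i \<Rightarrow> real" where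
  "arrival_rate S \<eta> u i =
     primary_rate S i + (\<Sum>e\<in>hyperedges S. pmf (\<eta> e u) i * overlap_rate S e)"

text \<open>
  At most one summand below is nonzero, and none is when \<open>u = v\<close>, because the map
  \<^term>\<open>state S\<close> is injective.
\<close>

definition transition_rate :: "'i::finite system \<Rightarrow> 'i policy \<Rightarrow> nat \<Rightarrow> nat \<Rightarrow> real" where
  "transition_rate S \<eta> u v =
     (\<Sum>i\<in>UNIV. if state S v = (state S u)(i := state S u i + 1)
                then arrival_rate S \<eta> u i else 0) +
     (\<Sum>i\<in>UNIV. if state S u i > 0 \<and> state S v = (state S u)(i := state S u i - 1)
                then service_rate S i else 0)"

definition generator :: "'i::finite system \<Rightarrow> 'i policy \<Rightarrow> nat \<Rightarrow> nat \<Rightarrow> real" where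
  "generator S \<eta> u v =
     (if u = v then - (\<Sum>\<^sub>\<infinity>w\<in>-{u}. transition_rate S \<eta> u w) else transition_rate S \<eta> u v)"

text \<open>
  Stationarity of \<open>\<pi>\<close> is \<open>\<pi> Q = 0\<close>. The rates out of a state are bounded by \<open>\<lambda> + (\<Sum>i. \<mu>\<^sub>i)\<close>,
  so the chain does not explode and this agrees with invariance under its transition semigroup.
\<close>

definition stationary :: "'i::finite system \<Rightarrow> 'i policy \<Rightarrow> nat pmf \<Rightarrow> bool" where
  "stationary S \<eta> \<pi> \<longleftrightarrow> (\<forall>v. ((\<lambda>u. pmf \<pi> u * generator S \<eta> u v) has_sum 0) UNIV)"

definition stable_policies :: "'i::finite system \<Rightarrow> 'i policy set" where
  "stable_policies S = {\<eta> \<in> policies S. \<exists>\<pi>. stationary S \<eta> \<pi>}"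

definition stationary_distribution :: "'i::finite system \<Rightarrow> 'i policy \<Rightarrow> nat pmf" where
  "stationary_distribution S \<eta> = (THE \<pi>. stationary S \<eta> \<pi>)"

definition workload :: "'i::finite system \<Rightarrow> 'i policy \<Rightarrow> 'i \<Rightarrow> real" where
  "workload S \<eta> i =
     (\<Sum>\<^sub>\<infinity>u. of_bool (state S u i > 0) * pmf (stationary_distribution S \<eta>) u)"

text \<open>
  A family indexed by the pairs \<open>(e, i)\<close> with \<open>e\<close> a hyperedge and \<open>i \<in> e\<close> is represented by the
  function \<open>'i set \<Rightarrow> 'i \<Rightarrow> real\<close> that extends it by \<open>0\<close>. So an arbitrary functional of such
  functions sees exactly the entries of the family.
\<close>

definition assignment_rate :: "'i::finite system \<Rightarrow> 'i policy \<Rightarrow> 'i set \<Rightarrow> 'i \<Rightarrow> real" where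
  "assignment_rate S \<eta> e i =
     (if e \<in> hyperedges S \<and> i \<in> e
      then overlap_rate S e *
             (\<Sum>\<^sub>\<infinity>u. pmf (stationary_distribution S \<eta>) u * pmf (\<eta> e u) i)
      else 0)"

definition overlap_fraction :: "'i::finite system \<Rightarrow> 'i policy \<Rightarrow> 'i set \<Rightarrow> 'i \<Rightarrow> real" where
  "overlap_fraction S \<eta> e i = assignment_rate S \<eta> e i / total_rate S"

definition primary_fraction :: "'i::finite system \<Rightarrow> 'i \<Rightarrow> real" where
  "primary_fraction S i = primary_rate S i / total_rate S"

text \<open>The variance of a vector across the servers, each server having weight \<open>1 / I\<close>.\<close>

definition server_variance :: "('i::finite \<Rightarrow> real) \<Rightarrow> real" where
  "server_variance r =
     (\<Sum>i\<in>UNIV. (r i - (\<Sum>j\<in>UNIV. r j) / real CARD('i))\<^sup>2) / real CARD('i)"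


definition flow_polytope :: "'i::finite system \<Rightarrow> ('i set \<Rightarrow> 'i \<Rightarrow> real) set" where
  "flow_polytope S =
     {x. (\<forall>e\<in>hyperedges S. \<forall>i\<in>e. x e i \<ge> 0) \<and>
         (\<forall>e\<in>hyperedges S. (\<Sum>i\<in>e. x e i) = overlap_rate S e) \<and>
         (\<forall>e i. \<not> (e \<in> hyperedges S \<and> i \<in> e) \<longrightarrow> x e i = 0)}"

definition server_inflow :: "'i::finite system \<Rightarrow> ('i set \<Rightarrow> 'i \<Rightarrow> real) \<Rightarrow> 'i \<Rightarrow> real" where
  "server_inflow S x i = primary_rate S i + (\<Sum>e\<in>{e \<in> hyperedges S. i \<in> e}. x e i)"

end

theory Submission
  imports Defs
begin

text \<open>
  Under a stable policy the stationary flow up from \<open>{n\<^sub>i = k}\<close> equals the flow down from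
  \<open>{n\<^sub>i = k + 1}\<close>; summing over \<open>k\<close> gives \<open>a\<^sub>i(x\<^sup>\<eta>) = \<mu>\<^sub>i \<rho>\<^sub>i\<^sup>\<eta>\<close>, and \<open>\<rho>\<^sub>i\<^sup>\<eta> < 1\<close> because the empty state, being
  reachable from everywhere, has positive mass. So the workloads are a function of the flow
  \<open>x\<^sup>\<eta>\<close>. Conversely, routing calls from \<open>e\<close> independently of the state with probabilities
  \<open>x\<^sub>e\<^sub>i / \<lambda>\<^sub>e\<close> turns the system into independent M/M/1 queues, whose reversible
  product-geometric distribution is stationary and realises the flow \<open>x\<close>.
\<close>

section \<open>Infinite sums and probability mass functions\<close>

lemma has_sum_pmf: "(pmf p has_sum 1) UNIV"
proof -
  have "pmf p summable_on UNIV"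
    by (rule Infinite_Sum.abs_summable_summable)
      (rule abs_summable_equivalent[THEN iffD2, OF pmf_abs_summable])
  moreover have "infsum (pmf p) UNIV = 1"
    by (subst infsetsum_infsum[OF pmf_abs_summable, symmetric])
      (rule infsetsum_pmf_eq_1[OF subset_UNIV])
  ultimately show ?thesis by (simp add: has_sum_iff)
qed

lemma summable_pmf_mult:
  assumes "\<And>u. \<bar>f u\<bar> \<le> (K::real)"
  shows "(\<lambda>u. pmf p u * f u) summable_on UNIV"
proof (rule Infinite_Sum.abs_summable_summable,
    rule Infinite_Sum.abs_summable_on_comparison_test'[where g = "\<lambda>u. pmf p u * K"])
  show "(\<lambda>u. pmf p u * K) summable_on UNIV"
    using has_sum_pmf[of p] by (intro summable_on_cmult_left) (rule has_sum_imp_summable)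
qed (auto simp: abs_mult intro!: mult_left_mono assms)

lemma pmf_mult_has_sum:
  "((\<lambda>u. pmf \<pi> u * pmf (p u) i) has_sum (\<Sum>\<^sub>\<infinity>u. pmf \<pi> u * pmf (p u) i)) UNIV"
  by (intro has_sum_infsum summable_pmf_mult[where K = 1]) (simp add: pmf_le_1)

text \<open>Keeping the total as a factor instead of dividing by it includes the total 0: then every
  \<open>x i\<close> vanishes and any distribution on \<open>e\<close> will do.\<close>

lemma exists_pmf_proportional:
  fixes x :: "'a::finite \<Rightarrow> real"
  assumes "e \<noteq> {}" "\<And>i. i \<in> e \<Longrightarrow> x i \<ge> 0" "\<And>i. i \<notin> e \<Longrightarrow> x i = 0"
  shows "\<exists>p. set_pmf p \<subseteq> e \<and> (\<forall>i. (\<Sum>j\<in>e. x j) * pmf p i = x i)"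
proof (cases "(\<Sum>j\<in>e. x j) = 0")
  case True
  obtain j where "j \<in> e" using assms(1) by blast
  have "x i = 0" for i
    using True assms(2,3) sum_nonneg_eq_0_iff[of e x] by (cases "i \<in> e") auto
  then show ?thesis using \<open>j \<in> e\<close> True by (intro exI[of _ "return_pmf j"]) auto
next
  case False
  define s where "s = (\<Sum>j\<in>e. x j)"
  have s: "s > 0" using False sum_nonneg[of e x] assms(2) by (simp add: s_def less_le)
  have x: "x i \<ge> 0" for i using assms(2,3) by (cases "i \<in> e") auto
  have "(\<Sum>i\<in>UNIV. x i / s) = 1"
  proof -
    have "(\<Sum>i\<in>UNIV. x i) = s"
      unfolding s_def by (rule sum.mono_neutral_right) (auto simp: assms(3))
    then show ?thesis using s by (simp add: sum_divide_distrib[symmetric])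
  qed
  then have "(\<integral>\<^sup>+i. ennreal (x i / s) \<partial>count_space UNIV) = 1"
    using x s by (simp add: nn_integral_count_space_finite sum_ennreal)
  with x s have p: "pmf (embed_pmf (\<lambda>i. x i / s)) i = x i / s" for i
    by (intro pmf_embed_pmf) auto
  show ?thesis
    using s by (intro exI[of _ "embed_pmf (\<lambda>i. x i / s)"])
      (auto simp: set_pmf_eq p s_def[symmetric] intro: ccontr assms(3))
qed

lemma has_sum_diff:
  fixes f g :: "'a \<Rightarrow> real"
  assumes "(f has_sum a) A" "(g has_sum b) A"
  shows "((\<lambda>x. f x - g x) has_sum (a - b)) A"
  using has_sum_add[OF assms(1) has_sum_cmult_right[OF assms(2), of "- 1"]] by simp

lemma has_sum_sum:
  fixes f :: "'b \<Rightarrow> 'a \<Rightarrow> real"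
  assumes "finite I" "\<And>i. i \<in> I \<Longrightarrow> (f i has_sum s i) A"
  shows "((\<lambda>x. \<Sum>i\<in>I. f i x) has_sum (\<Sum>i\<in>I. s i)) A"
  using assms by (induction I rule: finite_induct) (auto intro!: has_sum_add)

lemma has_sum_single:
  fixes c :: real
  shows "((\<lambda>x. if x = a then c else 0) has_sum c) UNIV"
  by (rule has_sum_finite_neutralI[of "{a}"]) auto

text \<open>Fubini over the disjoint union of the fibres of \<open>h\<close>; it later splits a
  stationary average according to the length of one queue.\<close>

lemma infsum_fibres:
  fixes g :: "'a \<Rightarrow> real" and h :: "'a \<Rightarrow> 'b"
  assumes "g summable_on UNIV"
  shows "(\<Sum>\<^sub>\<infinity>k. \<Sum>\<^sub>\<infinity>u. g u * of_bool (h u = k)) = infsum g UNIV"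
proof -
  have bij: "bij_betw (\<lambda>u. (h u, u)) UNIV (Sigma UNIV (\<lambda>k. {u. h u = k}))"
    by (auto simp: bij_betw_def inj_on_def)
  have "(\<lambda>x. g (snd x)) summable_on Sigma UNIV (\<lambda>k. {u. h u = k})"
    using summable_on_reindex_bij_betw[OF bij, of "\<lambda>x. g (snd x)"] assms by simp
  from infsum_Sigma_banach[OF this]
  have "(\<Sum>\<^sub>\<infinity>k. \<Sum>\<^sub>\<infinity>u\<in>{u. h u = k}. g u) = infsum g UNIV"
    using infsum_reindex_bij_betw[OF bij, of "\<lambda>x. g (snd x)"] by simp
  moreover have "(\<Sum>\<^sub>\<infinity>u. g u * of_bool (h u = k)) = (\<Sum>\<^sub>\<infinity>u\<in>{u. h u = k}. g u)" for k
    by (rule infsum_cong_neutral) auto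
  ultimately show ?thesis by simp
qed

section \<open>Invariant vectors of Markov chains with bounded rates\<close>

text \<open>Uniformly bounded exit rates make the flux of a summable vector absolutely summable, so
  sums over source and target can be interchanged. \<open>exit_rate\<close> is the full row sum,
  diagonal entry included.\<close>

locale bounded_rates =
  fixes q :: "'a \<Rightarrow> 'a \<Rightarrow> real" and exit_rate :: "'a \<Rightarrow> real" and C :: real
  assumes rate_nonneg: "q u v \<ge> 0"
    and row_has_sum: "(q u has_sum exit_rate u) UNIV"
    and exit_rate_le: "exit_rate u \<le> C"
begin

text \<open>The global balance equations. Vectors may be signed, so that the difference of two
  stationary distributions is again \<open>balanced\<close>.\<close>

definition balanced :: "('a \<Rightarrow> real) \<Rightarrow> bool" where
  "balanced d \<longleftrightarrow> d summable_on UNIV \<and>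
     (\<forall>v. ((\<lambda>u. d u * q u v) has_sum d v * exit_rate v) UNIV)"

lemma exit_rate_nonneg: "exit_rate u \<ge> 0"
  by (rule has_sum_nonneg[OF row_has_sum]) (rule rate_nonneg)

text \<open>The row of \<open>u\<close> has absolute sum at most
  \<open>\<bar>d u\<bar> * (M * C)\<close>, and this bound is summable over
  \<open>u\<close>.\<close>

lemma flux_summable:
  assumes d: "d summable_on UNIV" and f: "\<And>v. \<bar>f v\<bar> \<le> (M::real)"
  shows "(\<lambda>(u, v). d u * q u v * f v) summable_on UNIV \<times> UNIV"
proof (rule Infinite_Sum.abs_summable_summable,
    subst Infinite_Sum.abs_summable_on_Sigma_iff, intro conjI ballI)
  have M: "M \<ge> 0" using f[of undefined] by linarith
  have b: "norm (d u * q u v * f v) \<le> \<bar>d u\<bar> * M * q u v" for u v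
    using mult_left_mono[OF f[of v], of "\<bar>d u\<bar> * q u v"] rate_nonneg[of u v]
    by (simp add: abs_mult mult_ac)
  have hs: "((\<lambda>v. \<bar>d u\<bar> * M * q u v) has_sum \<bar>d u\<bar> * M * exit_rate u) UNIV" for u
    by (intro has_sum_cmult_right row_has_sum)
  show row: "(\<lambda>v. norm (case (u, v) of (u, v) \<Rightarrow> d u * q u v * f v)) summable_on UNIV" for u
    unfolding prod.case
    by (rule Infinite_Sum.abs_summable_on_comparison_test'[OF has_sum_imp_summable[OF hs[of u]]])
      (rule b)
  have le: "(\<Sum>\<^sub>\<infinity>v. norm (d u * q u v * f v)) \<le> \<bar>d u\<bar> * M * exit_rate u" for u
    using infsum_mono[OF row[of u, unfolded prod.case] has_sum_imp_summable[OF hs[of u]] b]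
      infsumI[OF hs[of u]] by simp
  have le': "\<bar>d u\<bar> * M * exit_rate u \<le> \<bar>d u\<bar> * (M * C)" for u
    using mult_left_mono[OF exit_rate_le[of u], of "\<bar>d u\<bar> * M"] M by (simp add: mult_ac)
  have "(\<lambda>u. \<bar>d u\<bar> * (M * C)) summable_on UNIV"
    using d summable_on_iff_abs_summable_on_real[of d UNIV] by (intro summable_on_cmult_left) simp
  then show "(\<lambda>u. norm (\<Sum>\<^sub>\<infinity>v. norm (case (u, v) of (u, v) \<Rightarrow> d u * q u v * f v))) summable_on UNIV"
    unfolding prod.case
  proof (rule Infinite_Sum.abs_summable_on_comparison_test')
    fix u
    have "(\<Sum>\<^sub>\<infinity>v. norm (d u * q u v * f v)) \<ge> 0" by (rule infsum_nonneg) simp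
    then show "norm (\<Sum>\<^sub>\<infinity>v. norm (d u * q u v * f v)) \<le> \<bar>d u\<bar> * (M * C)"
      using le[of u] le'[of u] by simp
  qed
qed

lemma exit_flux_summable:
  assumes "d summable_on UNIV" "\<And>v. \<bar>f v\<bar> \<le> (M::real)"
  shows "(\<lambda>u. d u * exit_rate u * f u) summable_on UNIV"
proof (rule Infinite_Sum.abs_summable_summable,
    rule Infinite_Sum.abs_summable_on_comparison_test'[where g = "\<lambda>u. \<bar>d u\<bar> * (C * M)"])
  show "(\<lambda>u. \<bar>d u\<bar> * (C * M)) summable_on UNIV"
    using assms(1) summable_on_iff_abs_summable_on_real[of d UNIV]
    by (intro summable_on_cmult_left) simp
  fix u
  have "exit_rate u * \<bar>f u\<bar> \<le> C * M"
    using exit_rate_nonneg[of u] exit_rate_le[of u] assms(2)[of u] by (intro mult_mono) auto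
  from mult_left_mono[OF this, of "\<bar>d u\<bar>"]
  show "norm (d u * exit_rate u * f u) \<le> \<bar>d u\<bar> * (C * M)"
    using exit_rate_nonneg[of u] by (simp add: abs_mult mult_ac)
qed

text \<open>The weak form of invariance: integrate the balance equations against \<open>f\<close>
  and interchange the two sums.\<close>

lemma balanced_test_function:
  assumes "balanced d" and f: "\<And>v. \<bar>f v\<bar> \<le> (M::real)"
  shows "(\<Sum>\<^sub>\<infinity>u. d u * (\<Sum>\<^sub>\<infinity>v. q u v * f v)) = (\<Sum>\<^sub>\<infinity>v. d v * exit_rate v * f v)"
proof -
  have d: "d summable_on UNIV" "((\<lambda>u. d u * q u v) has_sum d v * exit_rate v) UNIV" for v
    using assms(1) by (auto simp: balanced_def)
  have "(\<Sum>\<^sub>\<infinity>u. d u * (\<Sum>\<^sub>\<infinity>v. q u v * f v)) = (\<Sum>\<^sub>\<infinity>u. \<Sum>\<^sub>\<infinity>v. d u * q u v * f v)"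
    by (simp add: infsum_cmult_right' mult.assoc)
  also have "\<dots> = (\<Sum>\<^sub>\<infinity>v. \<Sum>\<^sub>\<infinity>u. d u * q u v * f v)"
    by (rule infsum_swap_banach[OF flux_summable[OF d(1) f]])
  also have "\<dots> = (\<Sum>\<^sub>\<infinity>v. d v * exit_rate v * f v)"
    by (simp add: infsum_cmult_left' infsumI[OF d(2)])
  finally show ?thesis .
qed

text \<open>Subinvariance of \<open>\<bar>d\<bar>\<close> is the triangle inequality; equality holds because the total
  inflow and the total outflow of \<open>\<bar>d\<bar>\<close> agree.\<close>

lemma balanced_abs:
  assumes "balanced d" shows "balanced (\<lambda>u. \<bar>d u\<bar>)"
proof -
  let ?a = "\<lambda>u. \<bar>d u\<bar>"
  have d: "d summable_on UNIV" "((\<lambda>u. d u * q u v) has_sum d v * exit_rate v) UNIV" for v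
    using assms(1) by (auto simp: balanced_def)
  have a: "?a summable_on UNIV"
    using d(1) summable_on_iff_abs_summable_on_real[of d UNIV] by simp
  have sum2: "(\<lambda>(u, v). ?a u * q u v) summable_on UNIV \<times> UNIV"
    using flux_summable[OF a, of "\<lambda>_. 1" 1] by simp
  have sum2': "(\<lambda>(v, u). ?a u * q u v) summable_on UNIV \<times> UNIV"
    using sum2 by (subst summable_on_swap) (simp add: case_prod_unfold)
  have col: "(\<lambda>u. ?a u * q u v) summable_on UNIV" for v
    by (rule summable_on_SigmaD1[OF sum2']) simp
  have cols: "(\<lambda>v. \<Sum>\<^sub>\<infinity>u. ?a u * q u v) summable_on UNIV"
    using summable_on_Sigma_banach[OF sum2'] by (simp only: prod.case)
  have ex: "(\<lambda>v. ?a v * exit_rate v) summable_on UNIV"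
    using exit_flux_summable[OF a, of "\<lambda>_. 1" 1] by (simp only: mult_1_right abs_one order_refl)
  define g where "g v = (\<Sum>\<^sub>\<infinity>u. ?a u * q u v) - ?a v * exit_rate v" for v
  have "g v \<ge> 0" for v
  proof -
    have "?a v * exit_rate v = norm (\<Sum>\<^sub>\<infinity>u. d u * q u v)"
      using exit_rate_nonneg[of v] by (simp add: infsumI[OF d(2)] abs_mult)
    also have "\<dots> \<le> (\<Sum>\<^sub>\<infinity>u. norm (d u * q u v))"
      using col[of v] rate_nonneg by (intro norm_infsum_bound) (simp add: abs_mult)
    also have "\<dots> = (\<Sum>\<^sub>\<infinity>u. ?a u * q u v)" using rate_nonneg by (simp add: abs_mult)
    finally show ?thesis by (simp add: g_def)
  qed
  moreover have "infsum g UNIV \<le> 0"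
  proof -
    have "(\<Sum>\<^sub>\<infinity>v. \<Sum>\<^sub>\<infinity>u. ?a u * q u v) = (\<Sum>\<^sub>\<infinity>u. \<Sum>\<^sub>\<infinity>v. ?a u * q u v)"
      by (rule infsum_swap_banach[OF sum2'])
    also have "\<dots> = (\<Sum>\<^sub>\<infinity>u. ?a u * exit_rate u)"
      by (simp add: infsum_cmult_right' infsumI[OF row_has_sum])
    finally show ?thesis
      unfolding g_def by (simp add:
          infsumI[OF has_sum_diff[OF has_sum_infsum[OF cols] has_sum_infsum[OF ex]]])
  qed
  moreover have "g summable_on UNIV" unfolding g_def
    by (rule has_sum_imp_summable[OF has_sum_diff[OF has_sum_infsum[OF cols] has_sum_infsum[OF ex]]])
  ultimately have "g v = 0" for v by (intro nonneg_infsum_le_0D[of g UNIV v]) auto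
  then have "(\<Sum>\<^sub>\<infinity>u. ?a u * q u v) = ?a v * exit_rate v" for v by (simp add: g_def)
  then show ?thesis using a has_sum_infsum[OF col] by (simp add: balanced_def)
qed

lemma balanced_add:
  assumes "balanced d" "balanced d'" shows "balanced (\<lambda>u. d u + d' u)"
  using assms unfolding balanced_def
  by (auto simp: distrib_right intro!: summable_on_add has_sum_add)

lemma balanced_cmult:
  assumes "balanced d" shows "balanced (\<lambda>u. c * d u)"
  using assms unfolding balanced_def
  by (auto simp: mult.assoc intro!: summable_on_cmult_right has_sum_cmult_right)

text \<open>The equation at \<open>v\<close> has a positive inflow term from \<open>u\<close> and no
  negative terms, so its right-hand side is positive.\<close>

lemma balanced_pos_step:
  assumes "balanced d" "\<And>u. d u \<ge> 0" "d u > 0" "q u v > 0"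
  shows "d v > 0"
proof -
  have hs: "((\<lambda>u. d u * q u v) has_sum d v * exit_rate v) UNIV"
    using assms(1) by (simp add: balanced_def)
  have "sum (\<lambda>u. d u * q u v) {u} \<le> d v * exit_rate v"
    using finite_sum_le_has_sum[OF hs, of "{u}"] assms(2) rate_nonneg by simp
  moreover have "d u * q u v > 0" using assms(3,4) by simp
  ultimately have "d v * exit_rate v > 0" by simp
  then show ?thesis using assms(2)[of v] by (cases "d v = 0") (auto simp: less_le)
qed

lemma balanced_pos_reach:
  assumes "balanced d" "\<And>u. d u \<ge> 0" "d u > 0" "(\<lambda>u v. q u v > 0)\<^sup>*\<^sup>* u v"
  shows "d v > 0"
  using assms(4,3)
proof (induction rule: rtranclp_induct)
  case (step y w)
  then show ?case using balanced_pos_step[OF assms(1,2), of y w] by simp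
qed

text \<open>The positive and the negative part of the difference of two invariant distributions are
  both invariant, so they cannot both be nonzero: each would be positive at \<open>z\<close>.\<close>

lemma balanced_unique:
  assumes "balanced d" "balanced d'" "infsum d UNIV = infsum d' UNIV"
    and reach: "\<And>u. (\<lambda>u v. q u v > 0)\<^sup>*\<^sup>* u z"
  shows "d = d'"
proof -
  define \<delta> where "\<delta> u = d u + (-1) * d' u" for u
  have \<delta>: "balanced \<delta>" unfolding \<delta>_def by (intro balanced_add balanced_cmult assms)
  have sm: "d summable_on UNIV" "d' summable_on UNIV" "\<delta> summable_on UNIV"
    using assms(1,2) \<delta> by (auto simp: balanced_def)
  have s0: "infsum \<delta> UNIV = 0"
    using infsumI[OF has_sum_diff[OF has_sum_infsum[OF sm(1)] has_sum_infsum[OF sm(2)]]] assms(3)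
    by (simp add: \<delta>_def[abs_def])
  \<comment> \<open>\<open>\<bar>\<delta>\<bar> + \<delta>\<close> and
    \<open>\<bar>\<delta>\<bar> - \<delta>\<close> are twice the positive and the negative part, so
    the closure properties of \<open>balanced\<close> apply.\<close>
  have pos: "balanced (\<lambda>u. \<bar>\<delta> u\<bar> + \<delta> u)" by (intro balanced_add balanced_abs \<delta>)
  have neg: "balanced (\<lambda>u. \<bar>\<delta> u\<bar> + (-1) * \<delta> u)"
    by (intro balanced_add balanced_abs balanced_cmult \<delta>)
  have "(\<forall>u. \<delta> u \<le> 0) \<or> (\<forall>u. \<delta> u \<ge> 0)"
  proof (rule ccontr)
    assume "\<not> ?thesis"
    then obtain u v where "\<delta> u > 0" "\<delta> v < 0" by (auto simp: not_le)
    then have "\<bar>\<delta> z\<bar> + \<delta> z > 0" "\<bar>\<delta> z\<bar> + (-1) * \<delta> z > 0"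
      using balanced_pos_reach[OF pos _ _ reach[of u]] balanced_pos_reach[OF neg _ _ reach[of v]]
      by auto
    then show False by linarith
  qed
  then have "\<delta> u = 0" for u
  proof
    assume "\<forall>u. \<delta> u \<ge> 0"
    then show ?thesis using nonneg_infsum_le_0D[of \<delta> UNIV u] s0 sm by auto
  next
    assume "\<forall>u. \<delta> u \<le> 0"
    then show ?thesis
      using nonneg_infsum_le_0D[of "\<lambda>u. - \<delta> u" UNIV u] s0 sm
      by (auto simp: infsum_uminus summable_on_uminus)
  qed
  then show ?thesis by (auto simp: \<delta>_def fun_eq_iff)
qed

end


section \<open>Transitions and generator of the dispatch chain\<close>

context dispatch_system
begin

definition up :: "'i \<Rightarrow> nat \<Rightarrow> nat" where
  "up i u = inv (state S) ((state S u)(i := state S u i + 1))"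

text \<open>Truncated subtraction makes \<open>down i u = u\<close> when queue \<open>i\<close> is
  empty; \<open>departure_rate\<close> vanishes there.\<close>

definition down :: "'i \<Rightarrow> nat \<Rightarrow> nat" where
  "down i u = inv (state S) ((state S u)(i := state S u i - 1))"

definition departure_rate :: "nat \<Rightarrow> 'i \<Rightarrow> real" where
  "departure_rate u i = of_bool (state S u i > 0) * service_rate S i"

definition exit_rate :: "'i policy \<Rightarrow> nat \<Rightarrow> real" where
  "exit_rate \<eta> u = (\<Sum>i\<in>UNIV. arrival_rate S \<eta> u i) + (\<Sum>i\<in>UNIV. departure_rate u i)"

lemma state_inv [simp]: "state S (inv (state S) n) = n"
  using state_bij by (simp add: bij_is_surj surj_f_inv_f)

lemma inv_state [simp]: "inv (state S) (state S u) = u"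
  using state_bij by (simp add: bij_is_inj)

lemma state_eq_iff: "state S v = n \<longleftrightarrow> v = inv (state S) n"
  by auto

lemma state_up [simp]: "state S (up i u) = (state S u)(i := state S u i + 1)"
  by (simp add: up_def)

lemma state_down [simp]: "state S (down i u) = (state S u)(i := state S u i - 1)"
  by (simp add: down_def)

text \<open>The positivity condition removes the truncated case, in which \<open>up\<close> does not
  undo \<open>down\<close>.\<close>

lemma up_eq_iff: "v = up i u \<longleftrightarrow> u = down i v \<and> state S v i > 0"
proof -
  have "v = up i u \<longleftrightarrow> state S v = (state S u)(i := state S u i + 1)"
    by (simp add: state_eq_iff up_def)
  also have "\<dots> \<longleftrightarrow> state S u = (state S v)(i := state S v i - 1) \<and> state S v i > 0"
    by (auto simp: fun_eq_iff)
  also have "\<dots> \<longleftrightarrow> u = down i v \<and> state S v i > 0"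
    by (simp add: state_eq_iff down_def)
  finally show ?thesis .
qed

lemma up_neq: "up i u \<noteq> u"
  using state_up[of i u] by (metis fun_upd_same n_not_Suc_n Suc_eq_plus1)

lemma arrival_rate_nonneg: "arrival_rate S \<eta> u i \<ge> 0"
  unfolding arrival_rate_def
  by (intro add_nonneg_nonneg primary_rate_nonneg sum_nonneg mult_nonneg_nonneg pmf_nonneg
      overlap_rate_nonneg)

lemma arrival_rate_le:
  "arrival_rate S \<eta> u i \<le> primary_rate S i + (\<Sum>e\<in>hyperedges S. overlap_rate S e)"
  unfolding arrival_rate_def
  by (intro add_left_mono sum_mono mult_left_le_one_le overlap_rate_nonneg pmf_nonneg pmf_le_1)

lemma departure_rate_nonneg: "departure_rate u i \<ge> 0"
  using service_rate_pos[of i] by (simp add: departure_rate_def)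

lemma departure_rate_le: "departure_rate u i \<le> service_rate S i"
  using service_rate_pos[of i] by (simp add: departure_rate_def)

lemma transition_rate_eq:
  "transition_rate S \<eta> u v =
     (\<Sum>i\<in>UNIV. if v = up i u then arrival_rate S \<eta> u i else 0) +
     (\<Sum>i\<in>UNIV. if v = down i u then departure_rate u i else 0)"
  unfolding transition_rate_def departure_rate_def
  by (intro arg_cong2[where f = "(+)"] sum.cong)
    (auto simp: state_eq_iff up_def down_def)

lemma transition_rate_nonneg: "transition_rate S \<eta> u v \<ge> 0"
  unfolding transition_rate_eq
  by (intro add_nonneg_nonneg sum_nonneg) (auto simp: arrival_rate_nonneg departure_rate_nonneg)

text \<open>\<open>u = down i u\<close> forces queue \<open>i\<close> to be empty, since otherwise
  \<open>u = up i u\<close> would follow; the departure then has rate 0.\<close>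

lemma transition_rate_self: "transition_rate S \<eta> u u = 0"
proof -
  have "departure_rate u i = 0" if "u = down i u" for i
    using that up_eq_iff[of u i u] up_neq[of i u] by (auto simp: departure_rate_def)
  then have "(\<Sum>i\<in>UNIV. if u = down i u then departure_rate u i else 0) = 0"
    by (intro sum.neutral) auto
  moreover have "(\<Sum>i\<in>UNIV. if u = up i u then arrival_rate S \<eta> u i else 0) = 0"
    using up_neq[of _ u] by (intro sum.neutral) (auto dest: sym)
  ultimately show ?thesis unfolding transition_rate_eq by simp
qed

text \<open>Each state has finitely many successors, so any real function can be summed against a
  row of rates.\<close>

lemma transition_has_sum:
  "((\<lambda>v. transition_rate S \<eta> u v * f v) has_sum
     (\<Sum>i\<in>UNIV. arrival_rate S \<eta> u i * f (up i u)) +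
     (\<Sum>i\<in>UNIV. departure_rate u i * f (down i u))) UNIV"
proof -
  have eq: "transition_rate S \<eta> u v * f v =
      (\<Sum>i\<in>UNIV. if v = up i u then arrival_rate S \<eta> u i * f (up i u) else 0) +
      (\<Sum>i\<in>UNIV. if v = down i u then departure_rate u i * f (down i u) else 0)" for v
    unfolding transition_rate_eq distrib_right sum_distrib_right
    by (intro arg_cong2[where f = "(+)"] sum.cong) auto
  show ?thesis unfolding eq by (intro has_sum_add has_sum_sum has_sum_single) auto
qed

text \<open>The constant charges every server with the whole overlapping demand. This crude bound
  uses only that probabilities are at most 1, so it holds for every \<open>\<eta>\<close>.\<close>

sublocale bounded_rates "transition_rate S \<eta>" "exit_rate \<eta>"
  "(\<Sum>i\<in>UNIV. primary_rate S i + (\<Sum>e\<in>hyperedges S. overlap_rate S e)) +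
     (\<Sum>i\<in>UNIV. service_rate S i)" for \<eta>
proof
  show "(transition_rate S \<eta> u has_sum exit_rate \<eta> u) UNIV" for u
    using transition_has_sum[of \<eta> u "\<lambda>_. 1"] by (simp add: exit_rate_def)
  show "exit_rate \<eta> u \<le> (\<Sum>i\<in>UNIV. primary_rate S i + (\<Sum>e\<in>hyperedges S. overlap_rate S e)) +
     (\<Sum>i\<in>UNIV. service_rate S i)" for u
    unfolding exit_rate_def by (intro add_mono sum_mono arrival_rate_le departure_rate_le)
qed (rule transition_rate_nonneg)

lemma generator_eq:
  "generator S \<eta> u v = transition_rate S \<eta> u v - (if u = v then exit_rate \<eta> v else 0)"
proof -
  have "(\<Sum>\<^sub>\<infinity>w\<in>-{u}. transition_rate S \<eta> u w) = (\<Sum>\<^sub>\<infinity>w. transition_rate S \<eta> u w)"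
    by (rule infsum_cong_neutral) (auto simp: transition_rate_self)
  then show ?thesis by (auto simp: generator_def transition_rate_self infsumI[OF row_has_sum])
qed

text \<open>Moving the diagonal term across turns zero net flux at \<open>v\<close> into inflow
  equals outflow.\<close>

lemma stationary_iff_balanced: "stationary S \<eta> \<pi> \<longleftrightarrow> balanced \<eta> (pmf \<pi>)"
proof -
  have eq: "pmf \<pi> u * generator S \<eta> u v =
      pmf \<pi> u * transition_rate S \<eta> u v - (if u = v then pmf \<pi> v * exit_rate \<eta> v else 0)" for u v
    by (simp add: generator_eq algebra_simps)
  have "((\<lambda>u. pmf \<pi> u * generator S \<eta> u v) has_sum 0) UNIV \<longleftrightarrow>
      ((\<lambda>u. pmf \<pi> u * transition_rate S \<eta> u v) has_sum pmf \<pi> v * exit_rate \<eta> v) UNIV" for v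
  proof
    assume "((\<lambda>u. pmf \<pi> u * generator S \<eta> u v) has_sum 0) UNIV"
    from has_sum_add[OF this has_sum_single[of v "pmf \<pi> v * exit_rate \<eta> v"]]
    show "((\<lambda>u. pmf \<pi> u * transition_rate S \<eta> u v) has_sum pmf \<pi> v * exit_rate \<eta> v) UNIV"
      unfolding eq by simp
  next
    assume "((\<lambda>u. pmf \<pi> u * transition_rate S \<eta> u v) has_sum pmf \<pi> v * exit_rate \<eta> v) UNIV"
    from has_sum_diff[OF this has_sum_single[of v "pmf \<pi> v * exit_rate \<eta> v"]]
    show "((\<lambda>u. pmf \<pi> u * generator S \<eta> u v) has_sum 0) UNIV"
      unfolding eq by simp
  qed
  then show ?thesis
    unfolding stationary_def balanced_def using has_sum_imp_summable[OF has_sum_pmf[of \<pi>]] by simp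
qed

section \<open>Reachability of the empty state and uniqueness of the stationary distribution\<close>

abbreviation origin :: nat where "origin \<equiv> inv (state S) (\<lambda>_. 0)"

lemma transition_rate_down_pos:
  assumes "state S u i > 0"
  shows "transition_rate S \<eta> u (down i u) > 0"
proof -
  have "0 < departure_rate u i"
    using assms service_rate_pos[of i] by (simp add: departure_rate_def)
  also have "\<dots> \<le> (\<Sum>j\<in>UNIV. if down i u = down j u then departure_rate u j else 0)"
    using member_le_sum[of i UNIV "\<lambda>j. if down i u = down j u then departure_rate u j else 0"]
      departure_rate_nonneg by simp
  also have "\<dots> \<le> transition_rate S \<eta> u (down i u)"
    unfolding transition_rate_eq by (simp add: sum_nonneg arrival_rate_nonneg)
  finally show ?thesis .
qed

text \<open>Induction on the number of calls present: departures alone empty the system. Arrival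
  rates may be 0, so the chain need not be irreducible; a state reachable from everywhere takes the
  place of irreducibility in the uniqueness argument.\<close>

lemma reach_origin: "(\<lambda>u v. transition_rate S \<eta> u v > 0)\<^sup>*\<^sup>* u origin"
proof (induction "\<Sum>i\<in>UNIV. state S u i" arbitrary: u)
  case 0
  then have "state S u = (\<lambda>_. 0)" by auto
  then show ?case by (simp add: state_eq_iff)
next
  case (Suc k)
  then obtain i where i: "state S u i > 0" by (metis gr0I nat.distinct(1) sum.neutral)
  have "(\<Sum>j\<in>UNIV. state S u j) = Suc (\<Sum>j\<in>UNIV. state S (down i u) j)"
    using i by (simp add: sum.remove[of UNIV i])
  with Suc have "(\<lambda>u v. transition_rate S \<eta> u v > 0)\<^sup>*\<^sup>* (down i u) origin" by simp
  with transition_rate_down_pos[OF i] show ?case by (meson converse_rtranclp_into_rtranclp)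
qed

lemma stationary_distribution_eq:
  assumes "stationary S \<eta> \<pi>"
  shows "stationary_distribution S \<eta> = \<pi>"
  unfolding stationary_distribution_def
proof (rule the_equality, rule assms)
  fix \<pi>' assume "stationary S \<eta> \<pi>'"
  then have "pmf \<pi>' = pmf \<pi>"
    using assms unfolding stationary_iff_balanced
    by (intro balanced_unique[OF _ _ _ reach_origin]) (auto simp: infsumI[OF has_sum_pmf])
  then show "\<pi>' = \<pi>" by (simp add: pmf_eq_iff)
qed

section \<open>Level crossings and flow balance\<close>

text \<open>Stationarity tested against the indicator of \<open>{n\<^sub>i \<le> k}\<close>.\<close>

lemma level_crossing:
  assumes "stationary S \<eta> \<pi>"
  shows "(\<Sum>\<^sub>\<infinity>u. pmf \<pi> u * arrival_rate S \<eta> u i * of_bool (state S u i = k)) =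
    (\<Sum>\<^sub>\<infinity>u. pmf \<pi> u * departure_rate u i * of_bool (state S u i = Suc k))"
proof -
  define f :: "nat \<Rightarrow> real" where "f v = of_bool (state S v i \<le> k)" for v
  define A where "A u = pmf \<pi> u * arrival_rate S \<eta> u i * of_bool (state S u i = k)" for u
  define B where "B u = pmf \<pi> u * departure_rate u i * of_bool (state S u i = Suc k)" for u
  define X where "X u = pmf \<pi> u * exit_rate \<eta> u * f u" for u
  define Y where "Y u = pmf \<pi> u * (\<Sum>\<^sub>\<infinity>v. transition_rate S \<eta> u v * f v)" for u
  have f: "\<bar>f v\<bar> \<le> 1" for v by (simp add: f_def)
  have bal: "balanced \<eta> (pmf \<pi>)" using assms by (simp add: stationary_iff_balanced)
  have "infsum Y UNIV = infsum X UNIV"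
    unfolding X_def Y_def by (rule balanced_test_function[OF bal f])
  have A: "A summable_on UNIV"
    unfolding A_def[abs_def] mult.assoc
    by (rule summable_pmf_mult[where K = "primary_rate S i + (\<Sum>e\<in>hyperedges S. overlap_rate S e)"])
      (use order_trans[OF arrival_rate_nonneg arrival_rate_le] in
        \<open>auto simp: of_bool_def arrival_rate_nonneg arrival_rate_le\<close>)
  have B: "B summable_on UNIV"
    unfolding B_def[abs_def] mult.assoc
    by (rule summable_pmf_mult[where K = "service_rate S i"])
      (use order_trans[OF departure_rate_nonneg departure_rate_le] in
        \<open>auto simp: of_bool_def departure_rate_nonneg departure_rate_le\<close>)
  have X: "X summable_on UNIV"
    unfolding X_def[abs_def] using has_sum_imp_summable[OF has_sum_pmf] f by (rule exit_flux_summable)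
  \<comment> \<open>Only events at server \<open>i\<close> crossing between levels \<open>k\<close>
    and \<open>Suc k\<close> change \<open>f\<close>: arrivals at level \<open>k\<close> lose the
    value 1, departures at level \<open>Suc k\<close> gain it.\<close>
  have "Y u = X u - A u + B u" for u
  proof -
    have a: "(\<Sum>j\<in>UNIV. arrival_rate S \<eta> u j * f (up j u)) =
        (\<Sum>j\<in>UNIV. arrival_rate S \<eta> u j * f u) - arrival_rate S \<eta> u i * of_bool (state S u i = k)"
    proof -
      have "arrival_rate S \<eta> u j * f (up j u) = arrival_rate S \<eta> u j * f u -
          (if j = i then arrival_rate S \<eta> u i * of_bool (state S u i = k) else 0)" for j
        by (auto simp: f_def)
      then show ?thesis by (simp add: sum_subtractf)
    qed
    have b: "(\<Sum>j\<in>UNIV. departure_rate u j * f (down j u)) =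
        (\<Sum>j\<in>UNIV. departure_rate u j * f u) + departure_rate u i * of_bool (state S u i = Suc k)"
    proof -
      have "departure_rate u j * f (down j u) = departure_rate u j * f u +
          (if j = i then departure_rate u i * of_bool (state S u i = Suc k) else 0)" for j
        by (auto simp: f_def departure_rate_def)
      then show ?thesis by (simp add: sum.distrib)
    qed
    show ?thesis
      unfolding Y_def X_def A_def B_def infsumI[OF transition_has_sum] a b exit_rate_def
        sum_distrib_right[symmetric]
      by (simp add: algebra_simps)
  qed
  then have "Y = (\<lambda>u. X u - A u + B u)" by (rule ext)
  then have "infsum Y UNIV = infsum X UNIV - infsum A UNIV + infsum B UNIV"
    by (simp only:) (intro infsumI has_sum_add has_sum_diff has_sum_infsum X A B)
  with \<open>infsum Y UNIV = infsum X UNIV\<close> show ?thesis by (simp add: A_def[abs_def] B_def[abs_def])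
qed

text \<open>Summing the level identities over \<open>k\<close> uses only bounded test functions and
  so avoids the queue length itself, whose mean may be infinite.\<close>

lemma flow_balance:
  assumes "stationary S \<eta> \<pi>"
  shows "(\<Sum>\<^sub>\<infinity>u. pmf \<pi> u * arrival_rate S \<eta> u i) =
    service_rate S i * (\<Sum>\<^sub>\<infinity>u. of_bool (state S u i > 0) * pmf \<pi> u)"
proof -
  have A: "(\<lambda>u. pmf \<pi> u * arrival_rate S \<eta> u i) summable_on UNIV"
    by (rule summable_pmf_mult[where K = "primary_rate S i + (\<Sum>e\<in>hyperedges S. overlap_rate S e)"])
      (simp add: arrival_rate_nonneg arrival_rate_le)
  have B: "(\<lambda>u. pmf \<pi> u * departure_rate u i) summable_on UNIV"
    by (rule summable_pmf_mult[where K = "service_rate S i"])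
      (simp add: departure_rate_nonneg departure_rate_le)
  have "(\<Sum>\<^sub>\<infinity>u. pmf \<pi> u * arrival_rate S \<eta> u i) =
      (\<Sum>\<^sub>\<infinity>k. \<Sum>\<^sub>\<infinity>u. pmf \<pi> u * arrival_rate S \<eta> u i * of_bool (state S u i = k))"
    by (rule infsum_fibres[OF A, symmetric])
  also have "\<dots> = (\<Sum>\<^sub>\<infinity>k. \<Sum>\<^sub>\<infinity>u. pmf \<pi> u * departure_rate u i * of_bool (state S u i = Suc k))"
    by (simp only: level_crossing[OF assms])
  \<comment> \<open>At an empty queue truncated subtraction gives \<open>0 - 1 = 0\<close>, so the
    term \<open>k = 0\<close> also picks up level 0; there \<open>departure_rate\<close> is
    0.\<close>
  also have "\<dots> = (\<Sum>\<^sub>\<infinity>k. \<Sum>\<^sub>\<infinity>u. pmf \<pi> u * departure_rate u i * of_bool (state S u i - 1 = k))"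
    by (intro infsum_cong) (auto simp: departure_rate_def)
  also have "\<dots> = (\<Sum>\<^sub>\<infinity>u. pmf \<pi> u * departure_rate u i)"
    by (rule infsum_fibres[OF B])
  also have "\<dots> = (\<Sum>\<^sub>\<infinity>u. service_rate S i * (of_bool (state S u i > 0) * pmf \<pi> u))"
    by (simp add: departure_rate_def mult_ac)
  finally show ?thesis by (simp add: infsum_cmult_right')
qed

lemma workload_less_1:
  assumes "stationary S \<eta> \<pi>"
  shows "(\<Sum>\<^sub>\<infinity>u. of_bool (state S u i > 0) * pmf \<pi> u) < 1"
proof -
  have bal: "balanced \<eta> (pmf \<pi>)" using assms by (simp add: stationary_iff_balanced)
  obtain u where "u \<in> set_pmf \<pi>" using set_pmf_not_empty[of \<pi>] by blast
  then have "pmf \<pi> u > 0" by (simp add: pmf_positive)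
  from balanced_pos_reach[OF bal _ this reach_origin] have pos: "pmf \<pi> origin > 0" by simp
  have "(\<lambda>u. pmf \<pi> u * of_bool (state S u i > 0)) summable_on UNIV"
    by (rule summable_pmf_mult[where K = 1]) simp
  then have s: "(\<lambda>u. of_bool (state S u i > 0) * pmf \<pi> u) summable_on UNIV"
    by (simp add: mult.commute)
  \<comment> \<open>The comparison function is \<open>\<pi>\<close> with the mass of
    \<open>origin\<close> removed; it dominates the busy part because every queue is empty at
    \<open>origin\<close>.\<close>
  have "((\<lambda>u. pmf \<pi> u - (if u = origin then pmf \<pi> origin else 0)) has_sum 1 - pmf \<pi> origin) UNIV"
    by (intro has_sum_diff has_sum_pmf has_sum_single)
  from has_sum_mono[OF has_sum_infsum[OF s] this]
  have "(\<Sum>\<^sub>\<infinity>u. of_bool (state S u i > 0) * pmf \<pi> u) \<le> 1 - pmf \<pi> origin" by auto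
  with pos show ?thesis by simp
qed

section \<open>The flow of a stable policy\<close>

lemma stationary_assignment_rate:
  assumes "stationary S \<eta> \<pi>"
  shows "assignment_rate S \<eta> e i =
    (if e \<in> hyperedges S \<and> i \<in> e then overlap_rate S e * (\<Sum>\<^sub>\<infinity>u. pmf \<pi> u * pmf (\<eta> e u) i) else 0)"
  by (simp add: assignment_rate_def stationary_distribution_eq[OF assms])

text \<open>Each \<open>\<eta> e u\<close> is carried by \<open>e\<close>, so its probabilities on
  \<open>e\<close> still sum to 1 after averaging over \<open>\<pi>\<close>.\<close>

lemma assignment_rate_in_flow_polytope:
  assumes "\<eta> \<in> policies S" "stationary S \<eta> \<pi>"
  shows "assignment_rate S \<eta> \<in> flow_polytope S"
  unfolding flow_polytope_def
proof (intro CollectI conjI ballI allI impI)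
  fix e i assume e: "e \<in> hyperedges S" and i: "i \<in> e"
  then show "assignment_rate S \<eta> e i \<ge> 0"
    by (auto simp: assignment_rate_def overlap_rate_nonneg intro!: mult_nonneg_nonneg infsum_nonneg)
next
  fix e assume e: "e \<in> hyperedges S"
  have "((\<lambda>u. \<Sum>i\<in>e. pmf \<pi> u * pmf (\<eta> e u) i) has_sum
      (\<Sum>i\<in>e. \<Sum>\<^sub>\<infinity>u. pmf \<pi> u * pmf (\<eta> e u) i)) UNIV"
    by (intro has_sum_sum pmf_mult_has_sum) simp
  moreover have "(\<Sum>i\<in>e. pmf \<pi> u * pmf (\<eta> e u) i) = pmf \<pi> u" for u
    using assms(1) e by (simp add: policies_def sum_distrib_left[symmetric] sum_pmf_eq_1)
  ultimately have "(\<Sum>i\<in>e. \<Sum>\<^sub>\<infinity>u. pmf \<pi> u * pmf (\<eta> e u) i) = 1"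
    using has_sum_unique[OF _ has_sum_pmf[of \<pi>]] by simp
  then show "(\<Sum>i\<in>e. assignment_rate S \<eta> e i) = overlap_rate S e"
    using e by (simp add: stationary_assignment_rate[OF assms(2)] sum_distrib_left[symmetric])
qed (auto simp: assignment_rate_def)

text \<open>A policy never sends a call of \<open>e\<close> outside \<open>e\<close>, so the sum
  over all hyperedges in \<open>arrival_rate\<close> reduces to those containing \<open>i\<close>.
  This connects the flow with \<open>flow_balance\<close>.\<close>

lemma server_inflow_assignment_rate:
  assumes "\<eta> \<in> policies S" "stationary S \<eta> \<pi>"
  shows "server_inflow S (assignment_rate S \<eta>) i = (\<Sum>\<^sub>\<infinity>u. pmf \<pi> u * arrival_rate S \<eta> u i)"
proof -
  have zero: "pmf (\<eta> e u) i = 0" if "e \<in> hyperedges S" "i \<notin> e" for e u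
    using assms(1) that by (auto simp: policies_def pmf_eq_0_set_pmf)
  let ?p = "\<lambda>e. \<Sum>\<^sub>\<infinity>u. pmf \<pi> u * pmf (\<eta> e u) i"
  have "((\<lambda>u. primary_rate S i * pmf \<pi> u +
      (\<Sum>e\<in>hyperedges S. overlap_rate S e * (pmf \<pi> u * pmf (\<eta> e u) i))) has_sum
      primary_rate S i * 1 + (\<Sum>e\<in>hyperedges S. overlap_rate S e * ?p e)) UNIV"
    by (intro has_sum_add has_sum_cmult_right has_sum_sum pmf_mult_has_sum has_sum_pmf) simp
  moreover have "primary_rate S i * pmf \<pi> u +
      (\<Sum>e\<in>hyperedges S. overlap_rate S e * (pmf \<pi> u * pmf (\<eta> e u) i)) =
      pmf \<pi> u * arrival_rate S \<eta> u i" for u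
    by (simp add: arrival_rate_def distrib_left sum_distrib_left mult_ac)
  ultimately have "(\<Sum>\<^sub>\<infinity>u. pmf \<pi> u * arrival_rate S \<eta> u i) =
      primary_rate S i + (\<Sum>e\<in>hyperedges S. overlap_rate S e * ?p e)"
    by (simp add: infsumI)
  also have "(\<Sum>e\<in>hyperedges S. overlap_rate S e * ?p e) =
      (\<Sum>e\<in>{e \<in> hyperedges S. i \<in> e}. assignment_rate S \<eta> e i)"
    by (rule sum.mono_neutral_cong_right)
      (auto simp: zero stationary_assignment_rate[OF assms(2)])
  finally show ?thesis by (simp add: server_inflow_def)
qed

text \<open>One half of the correspondence: a stable policy enters the objective only through its
  flow, which is admissible in the right-hand infimum.\<close>

lemma stable_policy_flow:
  assumes "\<eta> \<in> stable_policies S"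
  shows "assignment_rate S \<eta> \<in> flow_polytope S"
    and "server_inflow S (assignment_rate S \<eta>) i < service_rate S i"
    and "workload S \<eta> = (\<lambda>i. server_inflow S (assignment_rate S \<eta>) i / service_rate S i)"
proof -
  obtain \<pi> where \<eta>: "\<eta> \<in> policies S" and \<pi>: "stationary S \<eta> \<pi>"
    using assms by (auto simp: stable_policies_def)
  show "assignment_rate S \<eta> \<in> flow_polytope S"
    by (rule assignment_rate_in_flow_polytope[OF \<eta> \<pi>])
  have eq: "server_inflow S (assignment_rate S \<eta>) i =
      service_rate S i * (\<Sum>\<^sub>\<infinity>u. of_bool (state S u i > 0) * pmf \<pi> u)" for i
    by (simp only: server_inflow_assignment_rate[OF \<eta> \<pi>] flow_balance[OF \<pi>])
  show "server_inflow S (assignment_rate S \<eta>) i < service_rate S i"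
    unfolding eq using mult_strict_left_mono[OF workload_less_1[OF \<pi>] service_rate_pos] by simp
  show "workload S \<eta> = (\<lambda>i. server_inflow S (assignment_rate S \<eta>) i / service_rate S i)"
    unfolding workload_def stationary_distribution_eq[OF \<pi>] eq
    using service_rate_pos by (simp add: less_imp_neq[symmetric])
qed

section \<open>State-independent policies realising a given flow\<close>

lemma stationary_product_geometric:
  assumes arr: "\<And>u i. arrival_rate S \<eta> u i = a i" and a: "\<And>i. a i < service_rate S i"
  shows "\<exists>\<pi>. stationary S \<eta> \<pi>"
proof -
  define \<rho> where "\<rho> i = a i / service_rate S i" for i
  have a0: "a i \<ge> 0" for i using arr arrival_rate_nonneg by metis
  have \<rho>: "0 \<le> \<rho> i" "\<rho> i < 1" "\<rho> i * service_rate S i = a i" for i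
    using a0[of i] a[of i] service_rate_pos[of i] by (auto simp: \<rho>_def)
  \<comment> \<open>\<open>geometric_pmf (1 - \<rho> i)\<close> gives \<open>n\<close> the mass
    \<open>\<rho> i ^ n * (1 - \<rho> i)\<close>, the M/M/1 queue length law. The default 0 of
    \<open>Pi_pmf\<close> never occurs, as the index set is \<open>UNIV\<close>; the map transports
    the law to state numbers.\<close>
  define \<pi> where "\<pi> = map_pmf (inv (state S)) (Pi_pmf UNIV 0 (\<lambda>i. geometric_pmf (1 - \<rho> i)))"
  have inj: "inj (inv (state S))" by (rule inj_on_inverseI[of _ "state S"]) simp
  have \<pi>: "pmf \<pi> u = (\<Prod>i\<in>UNIV. \<rho> i ^ state S u i * (1 - \<rho> i))" for u
  proof -
    have "pmf \<pi> (inv (state S) (state S u)) =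
        pmf (Pi_pmf UNIV 0 (\<lambda>i. geometric_pmf (1 - \<rho> i))) (state S u)"
      unfolding \<pi>_def by (rule pmf_map_inj'[OF inj])
    also have "\<dots> = (\<Prod>i\<in>UNIV. \<rho> i ^ state S u i * (1 - \<rho> i))"
      using \<rho> by (subst pmf_Pi') (auto intro!: prod.cong)
    finally show ?thesis by simp
  qed
  have up: "pmf \<pi> (up i u) = \<rho> i * pmf \<pi> u" for i u
    unfolding \<pi> by (simp add: prod.remove[of UNIV i])
  \<comment> \<open>Detailed balance for one server: both sides vanish unless \<open>v\<close>
    arises from \<open>u\<close> by an arrival at \<open>i\<close>, and then
    \<open>\<rho> i * service_rate S i = a i\<close> matches them.\<close>
  have reversible: "pmf \<pi> u * (if v = up i u then arrival_rate S \<eta> u i else 0) =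
      pmf \<pi> v * (if u = down i v then departure_rate v i else 0)" for u v i
  proof (cases "v = up i u")
    case True
    then have "u = down i v" "state S v i > 0" using up_eq_iff by blast+
    then show ?thesis using True by (simp add: up arr departure_rate_def \<rho>(3)[symmetric])
  next
    case False
    then show ?thesis using up_eq_iff[of v i u] by (auto simp: departure_rate_def)
  qed
  have detailed_balance:
    "pmf \<pi> u * transition_rate S \<eta> u v = pmf \<pi> v * transition_rate S \<eta> v u" for u v
    unfolding transition_rate_eq distrib_left sum_distrib_left reversible
    by (simp only: reversible[symmetric] add.commute)
  \<comment> \<open>Detailed balance rewrites the inflow to \<open>v\<close> as
    \<open>pmf \<pi> v\<close> times the row of \<open>v\<close>, whose sum is the exit
    rate.\<close>
  have "balanced \<eta> (pmf \<pi>)"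
    unfolding balanced_def detailed_balance
    by (intro conjI allI has_sum_cmult_right row_has_sum has_sum_imp_summable[OF has_sum_pmf])
  then show ?thesis by (auto simp: stationary_iff_balanced)
qed

text \<open>The converse half. The flows agree as functions because both are 0 off the pairs of a
  hyperedge \<open>e\<close> and a server in \<open>e\<close>.\<close>

lemma flow_realised:
  assumes x: "x \<in> flow_polytope S" and stable: "\<And>i. server_inflow S x i < service_rate S i"
  shows "\<exists>\<eta>\<in>stable_policies S. state_independent S \<eta> \<and> assignment_rate S \<eta> = x"
proof -
  have x0: "x e i = 0" if "e \<notin> hyperedges S \<or> i \<notin> e" for e i
    using x that by (auto simp: flow_polytope_def)
  have "\<forall>e\<in>hyperedges S. \<exists>p. set_pmf p \<subseteq> e \<and> (\<forall>i. overlap_rate S e * pmf p i = x e i)"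
  proof
    fix e assume e: "e \<in> hyperedges S"
    then have "(\<Sum>i\<in>e. x e i) = overlap_rate S e" "\<And>i. i \<in> e \<Longrightarrow> x e i \<ge> 0"
      using x by (auto simp: flow_polytope_def)
    then show "\<exists>p. set_pmf p \<subseteq> e \<and> (\<forall>i. overlap_rate S e * pmf p i = x e i)"
      using exists_pmf_proportional[of e "x e"] hyperedge_nonempty[OF e] x0 by simp
  qed
  then obtain p where p: "\<And>e. e \<in> hyperedges S \<Longrightarrow> set_pmf (p e) \<subseteq> e"
      "\<And>e i. e \<in> hyperedges S \<Longrightarrow> overlap_rate S e * pmf (p e) i = x e i"
    by (metis bchoice)
  define \<eta> :: "'i policy" where "\<eta> e u = p e" for e u
  have "arrival_rate S \<eta> u i = server_inflow S x i" for u i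
  proof -
    have "(\<Sum>e\<in>hyperedges S. pmf (p e) i * overlap_rate S e) =
        (\<Sum>e\<in>{e \<in> hyperedges S. i \<in> e}. x e i)"
      by (rule sum.mono_neutral_cong_right) (auto simp: mult.commute p(2) x0)
    then show ?thesis by (simp add: arrival_rate_def server_inflow_def \<eta>_def)
  qed
  from stationary_product_geometric[OF this stable] obtain \<pi> where \<pi>: "stationary S \<eta> \<pi>" by blast
  have "\<eta> \<in> stable_policies S"
    using \<pi> p(1) by (auto simp: stable_policies_def policies_def \<eta>_def)
  moreover have "state_independent S \<eta>" by (simp add: state_independent_def \<eta>_def)
  \<comment> \<open>A probability that does not depend on the state averages to itself under
    \<open>\<pi>\<close>.\<close>
  moreover have "assignment_rate S \<eta> = x"
    using p(2) x0
    by (auto simp: fun_eq_iff stationary_assignment_rate[OF \<pi>] \<eta>_def infsum_cmult_left'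
        infsumI[OF has_sum_pmf])
  ultimately show ?thesis by blast
qed

text \<open>Realising the flow of \<open>\<eta>\<close> without state dependence keeps the workloads
  too, since they are computed from the flow.\<close>

lemma state_independent_equivalent:
  assumes "\<eta> \<in> stable_policies S"
  shows "\<exists>\<eta>'\<in>{\<eta> \<in> stable_policies S. state_independent S \<eta>}.
    assignment_rate S \<eta>' = assignment_rate S \<eta> \<and> workload S \<eta>' = workload S \<eta>"
  using flow_realised[of "assignment_rate S \<eta>"] stable_policy_flow[OF assms]
  by (fastforce simp: stable_policy_flow(3))

end

section \<open>The identities between infima\<close>

text \<open>Values are cast to \<open>ereal\<close>, so that an infimum over the empty set is
  \<infinity> and objectives unbounded below are covered.\<close>

theorem corollary1:
  fixes S :: "'i::finite system"
    and \<Phi> :: "('i \<Rightarrow> real) \<Rightarrow> ('i set \<Rightarrow> 'i \<Rightarrow> real) \<Rightarrow> real"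
  assumes "dispatch_system S"
  shows
    "(INF \<eta>\<in>stable_policies S. ereal (\<Phi> (workload S \<eta>) (assignment_rate S \<eta>))) =
       (INF x\<in>{x \<in> flow_polytope S. \<forall>i. server_inflow S x i < service_rate S i}.
          ereal (\<Phi> (\<lambda>i. server_inflow S x i / service_rate S i) x))
     \<and>
     (\<forall>F :: ('i \<Rightarrow> real) \<Rightarrow> real \<Rightarrow> real.
        (INF \<eta>\<in>stable_policies S.
           ereal (F (workload S \<eta>) (server_variance (workload S \<eta>)))) =
        (INF \<eta>\<in>{\<eta> \<in> stable_policies S. state_independent S \<eta>}.
           ereal (F (workload S \<eta>) (server_variance (workload S \<eta>)))))
     \<and>
     (total_rate S > 0 \<longrightarrow>
       (\<forall>F :: ('i \<Rightarrow> real) \<Rightarrow> real \<Rightarrow> ('i set \<Rightarrow> 'i \<Rightarrow> real) \<Rightarrow> ('i \<Rightarrow> real) \<Rightarrow> real.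
          (INF \<eta>\<in>stable_policies S.
             ereal (F (workload S \<eta>) (server_variance (workload S \<eta>))
                      (overlap_fraction S \<eta>) (primary_fraction S))) =
          (INF \<eta>\<in>{\<eta> \<in> stable_policies S. state_independent S \<eta>}.
             ereal (F (workload S \<eta>) (server_variance (workload S \<eta>))
                      (overlap_fraction S \<eta>) (primary_fraction S)))))"
proof -
  interpret dispatch_system S by fact
  have flows: "(INF \<eta>\<in>stable_policies S. ereal (\<Phi> (workload S \<eta>) (assignment_rate S \<eta>))) =
       (INF x\<in>{x \<in> flow_polytope S. \<forall>i. server_inflow S x i < service_rate S i}.
          ereal (\<Phi> (\<lambda>i. server_inflow S x i / service_rate S i) x))"
  proof (rule INF_eq)
    fix \<eta> assume "\<eta> \<in> stable_policies S"
    then show "\<exists>x\<in>{x \<in> flow_polytope S. \<forall>i. server_inflow S x i < service_rate S i}.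
        ereal (\<Phi> (\<lambda>i. server_inflow S x i / service_rate S i) x)
          \<le> ereal (\<Phi> (workload S \<eta>) (assignment_rate S \<eta>))"
      using stable_policy_flow[of \<eta>] by (intro bexI[of _ "assignment_rate S \<eta>"]) auto
  next
    fix x assume "x \<in> {x \<in> flow_polytope S. \<forall>i. server_inflow S x i < service_rate S i}"
    then obtain \<eta> where "\<eta> \<in> stable_policies S" "assignment_rate S \<eta> = x"
      using flow_realised[of x] by auto
    then show "\<exists>\<eta>\<in>stable_policies S. ereal (\<Phi> (workload S \<eta>) (assignment_rate S \<eta>))
        \<le> ereal (\<Phi> (\<lambda>i. server_inflow S x i / service_rate S i) x)"
      using stable_policy_flow(3)[of \<eta>] by (intro bexI[of _ \<eta>]) auto
  qed
  \<comment> \<open>\<open>G\<close> is arbitrary, and the variance and the fractions are functions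
    of workloads and assignment rates, so both remaining claims are instances.\<close>
  have state_dependence:
    "(INF \<eta>\<in>stable_policies S. ereal (G (workload S \<eta>) (assignment_rate S \<eta>))) =
     (INF \<eta>\<in>{\<eta> \<in> stable_policies S. state_independent S \<eta>}.
        ereal (G (workload S \<eta>) (assignment_rate S \<eta>)))" for G
  proof (rule INF_eq)
    fix \<eta> assume "\<eta> \<in> stable_policies S"
    from state_independent_equivalent[OF this]
    show "\<exists>\<eta>'\<in>{\<eta> \<in> stable_policies S. state_independent S \<eta>}.
        ereal (G (workload S \<eta>') (assignment_rate S \<eta>'))
          \<le> ereal (G (workload S \<eta>) (assignment_rate S \<eta>))"
      by fastforce
  \<comment> \<open>The reverse inequality: state-independent stable policies are among the stable
    ones.\<close>
  qed auto
  show ?thesis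
    unfolding overlap_fraction_def[abs_def]
    using flows state_dependence[of "\<lambda>\<rho> _. F \<rho> (server_variance \<rho>)" for F]
      state_dependence[of "\<lambda>\<rho> x. F \<rho> (server_variance \<rho>) (\<lambda>e i. x e i / total_rate S)
        (primary_fraction S)" for F]
    by blast
qed

end
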